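(* Let $q$ be a prime power and let $\mathbb{G}_{q\mid\varphi}$ be the graph whose vertices are the points of the projective plane $\mathrm{PG}(2,q)$ (the $1$-dimensional linear subspaces of $\mathbb{F}_q^3$), two distinct points being adjacent if and only if they are orthogonal as subspaces of $\mathbb{F}_q^3$. Let $k$ be a positive integer such that $5k^2-k-10\leqslant 2q$. Then $\mathbb{G}_{q\mid\varphi}$ is $k$-vertex-minor universal.
   Context: Orthogonality is with respect to the standard bilinear form $\langle x,y\rangle = x_1y_1+x_2y_2+x_3y_3$ on $\mathbb{F}_q^3$. Equivalently, $\mathbb{G}_{q\mid\varphi}$ is the reduction of the bipartite point-line incidence graph $\mathbb{G}_q$ of $\mathrm{PG}(2,q)$ by the bijection $\varphi$ sending a point $a$ to the line $\varphi(a)$ corresponding to the $2$-dimensional subspace orthogonal to $a$: its vertices are the points, and distinct points $a\neq b$ are adjacent iff $a\in\varphi(b)$ or $b\in\varphi(a)$ (these two conditions being equivalent). There are no loops, even at self-orthogonal points. All graphs are finite, undirected and simple. A local complementation on a vertex $v$ of $G$ complements the subgraph induced by the neighborhood of $v$: the resulting graph has the same vertex set and edge set $E(G)\oplus E(K_{N_G(v)})$, where $K_S$ is the complete graph on $S$ and $\oplus$ is symmetric difference. A graph $G'$ with $V(G')\subseteq V(G)$ is a vertex-minor of $G$ if $G'$ is obtained exactly (not only up to isomorphism) from $G$ by a sequence of local complementations and deletions of the vertices of $V(G)\setminus V(G')$. For an integer $k>0$, $G$ is $k$-vertex-minor universal if $k\leqslant |V(G)|$ and, for every set $K$ of $k$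 vertices of $G$, every graph with vertex set $K$ is a vertex-minor of $G$. *)

theory Defs
  imports
    "HOL-Analysis.Analysis"
    "HOL-Number_Theory.Prime_Powers"
    "Graph_Theory.Pair_Digraph"
begin

text \<open>
  Finite simple undirected graphs are \<^term>\<open>pair_graph\<close>s: an undirected edge between \<open>u\<close> and
  \<open>v\<close> is represented by the two arcs \<open>(u, v)\<close> and \<open>(v, u)\<close>.
\<close>

definition neighborhood :: "'v pair_pre_digraph \<Rightarrow> 'v \<Rightarrow> 'v set" where
  "neighborhood G v = {u. (v, u) \<in> parcs G}"

definition complete_arcs :: "'v set \<Rightarrow> ('v \<times> 'v) set" where
  "complete_arcs S = {(x, y). x \<in> S \<and> y \<in> S \<and> x \<noteq> y}"

definition local_complement :: "'v pair_pre_digraph \<Rightarrow> 'v \<Rightarrow> 'v pair_pre_digraph" where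
  "local_complement G v =
     \<lparr> pverts = pverts G, parcs = sym_diff (parcs G) (complete_arcs (neighborhood G v)) \<rparr>"

definition delete_vertex :: "'v pair_pre_digraph \<Rightarrow> 'v \<Rightarrow> 'v pair_pre_digraph" where
  "delete_vertex G v =
     \<lparr> pverts = pverts G - {v}, parcs = {e \<in> parcs G. fst e \<noteq> v \<and> snd e \<noteq> v} \<rparr>"

lemma with_proj_delete_vertex:
  "with_proj (delete_vertex G v) = pre_digraph.del_vert (with_proj G) v"
  by (simp add: with_proj_def delete_vertex_def pre_digraph.del_vert_def)

lemma pair_graph_local_complement:
  assumes "pair_graph G"
  shows "pair_graph (local_complement G v)"
proof -
  interpret pair_graph G by fact
  have fin: "finite (neighborhood G v)"
    by (rule finite_subset[OF _ pair_finite_verts]) (auto simp: neighborhood_def dest: in_arcsD2)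
  have "finite (complete_arcs (neighborhood G v))"
    by (rule finite_subset[of _ "neighborhood G v \<times> neighborhood G v"])
       (auto simp: complete_arcs_def fin)
  then show ?thesis
    by unfold_locales
       (auto simp: local_complement_def complete_arcs_def neighborhood_def symmetric_def sym_def
          pair_finite_verts pair_finite_arcs dest: in_arcsD1 in_arcsD2 no_loops' arcs_symmetric)
qed

lemma pair_graph_delete_vertex:
  assumes "pair_graph G"
  shows "pair_graph (delete_vertex G v)"
proof -
  interpret pair_graph G by fact
  show ?thesis
    by unfold_locales
       (auto simp: delete_vertex_def symmetric_def sym_def
          pair_finite_verts pair_finite_arcs dest: in_arcsD1 in_arcsD2 no_loops' arcs_symmetric)
qed

text \<open>
  \<open>vertex_minor G H\<close> states that \<open>H\<close> is a vertex-minor of \<open>G\<close>. Equality of graphs is on the nose;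
  the deleted vertices are necessarily those in \<^term>\<open>pverts G - pverts H\<close>.
\<close>

inductive vertex_minor :: "'v pair_pre_digraph \<Rightarrow> 'v pair_pre_digraph \<Rightarrow> bool" where
  refl: "vertex_minor G G"
| local_complement:
    "vertex_minor G H \<Longrightarrow> v \<in> pverts H \<Longrightarrow> vertex_minor G (local_complement H v)"
| delete_vertex:
    "vertex_minor G H \<Longrightarrow> v \<in> pverts H \<Longrightarrow> vertex_minor G (delete_vertex H v)"

definition vertex_minor_universal :: "nat \<Rightarrow> 'v pair_pre_digraph \<Rightarrow> bool" where
  "vertex_minor_universal k G \<longleftrightarrow>
     k \<le> card (pverts G) \<and>
     (\<forall>K H. K \<subseteq> pverts G \<and> card K = k \<and> pair_graph H \<and> pverts H = K \<longrightarrow> vertex_minor G H)"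

definition pg2_points :: "('a::field ^ 3) set set" where
  "pg2_points = {S. vec.subspace S \<and> vec.dim S = 1}"

definition orthogonal_subspaces :: "('a::field ^ 3) set \<Rightarrow> ('a ^ 3) set \<Rightarrow> bool" where
  "orthogonal_subspaces S T \<longleftrightarrow> (\<forall>x\<in>S. \<forall>y\<in>T. scalar_product x y = 0)"

definition orthogonality_graph :: "('a::field ^ 3) set pair_pre_digraph" where
  "orthogonality_graph =
     \<lparr> pverts = pg2_points,
       parcs = {(a, b). a \<in> pg2_points \<and> b \<in> pg2_points \<and> a \<noteq> b \<and> orthogonal_subspaces a b} \<rparr>"

lemma orthogonal_subspaces_sym: "orthogonal_subspaces S T \<longleftrightarrow> orthogonal_subspaces T S"
  unfolding orthogonal_subspaces_def scalar_product_def by (subst mult.commute) blast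

lemma pair_graph_orthogonality_graph:
  "pair_graph (orthogonality_graph :: ('a::{field, finite} ^ 3) set pair_pre_digraph)"
  by unfold_locales
     (auto simp: orthogonality_graph_def symmetric_def sym_def intro: orthogonal_subspaces_sym[THEN iffD1])

end

theory Submission
  imports Defs
begin

text \<open>
  To pass from the graph induced on \<open>K\<close> to a prescribed graph on \<open>K\<close>, every pair \<open>u\<close>, \<open>v\<close> of \<open>K\<close>
  on which the two differ is joined by an induced path whose inner vertices lie outside \<open>K\<close> and
  are adjacent to nothing else: complementing at an inner vertex and deleting it shortens the
  path, and the last such step toggles \<open>uv\<close>. If \<open>u\<close> and \<open>v\<close> are not orthogonal, two inner
  vertices \<open>a \<in> u\<^sup>\<bottom>\<close> and \<open>b = a\<^sup>\<bottom> \<inter> v\<^sup>\<bottom>\<close> suffice; otherwise three are needed, \<open>a \<in> u\<^sup>\<bottom>\<close>,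
  \<open>c \<in> v\<^sup>\<bottom>\<close> and \<open>b = a\<^sup>\<bottom> \<inter> c\<^sup>\<bottom>\<close>. The paths are chosen greedily. With a set \<open>Z\<close> of vertices already
  in use, about \<open>2 |Z|\<close> of the \<open>q + 1\<close> points of a line are forbidden. Finally \<open>|Z|\<close> is controlled
  because the orthogonality graph has no 4-cycle, so that few pairs of \<open>K\<close> need the longer path.
\<close>

section \<open>Suppressing vertices of degree two\<close>

lemma vertex_minor_trans:
  assumes "vertex_minor G H" "vertex_minor H I"
  shows "vertex_minor G I"
  using assms(2,1) by induction (auto intro: vertex_minor.intros)

text \<open>The neighborhood of such a vertex contains a single pair, so complementing there and
  then deleting the vertex toggles just this pair.\<close>

lemma suppress_vertex:
  assumes "w \<in> V" "w \<noteq> x" "w \<noteq> y" "x \<noteq> y"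
    and out: "\<And>z. (w, z) \<in> R \<longleftrightarrow> z = x \<or> z = y"
  shows "vertex_minor \<lparr>pverts = V, parcs = R\<rparr>
    \<lparr>pverts = V - {w},
     parcs = sym_diff {e \<in> R. fst e \<noteq> w \<and> snd e \<noteq> w} {(x, y), (y, x)}\<rparr>"
proof -
  let ?G = "\<lparr>pverts = V, parcs = R\<rparr>"
  have "neighborhood ?G w = {x, y}"
    unfolding neighborhood_def using out by simp blast
  then have lc: "local_complement ?G w = \<lparr>pverts = V, parcs = sym_diff R {(x, y), (y, x)}\<rparr>"
    using \<open>x \<noteq> y\<close> by (auto simp: local_complement_def complete_arcs_def)
  have "vertex_minor ?G (delete_vertex (local_complement ?G w) w)"
    by (intro vertex_minor.delete_vertex vertex_minor.local_complement vertex_minor.refl)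
      (use assms(1) in \<open>simp_all add: local_complement_def\<close>)
  also have "delete_vertex (local_complement ?G w) w =
    \<lparr>pverts = V - {w},
     parcs = sym_diff {e \<in> R. fst e \<noteq> w \<and> snd e \<noteq> w} {(x, y), (y, x)}\<rparr>"
    unfolding lc delete_vertex_def using assms(2,3) by auto
  finally show ?thesis .
qed

text \<open>Suppressing \<open>a\<close> shortens the path u-a-b-v to u-b-v, where \<open>b\<close>
  has degree two again; suppressing \<open>b\<close> then toggles the pair \<open>u\<close>,
  \<open>v\<close>.\<close>

lemma suppress_path2:
  assumes "a \<in> V" "b \<in> V" "distinct [a, b, u, v]"
    and a: "\<And>z. (a, z) \<in> R \<longleftrightarrow> z = u \<or> z = b" "\<And>z. (z, a) \<in> R \<longleftrightarrow> z = u \<or> z = b"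
    and b: "\<And>z. (b, z) \<in> R \<longleftrightarrow> z = a \<or> z = v" "\<And>z. (z, b) \<in> R \<longleftrightarrow> z = a \<or> z = v"
  shows "vertex_minor \<lparr>pverts = V, parcs = R\<rparr>
    \<lparr>pverts = V - {a, b},
     parcs = sym_diff {e \<in> R. fst e \<notin> {a, b} \<and> snd e \<notin> {a, b}} {(u, v), (v, u)}\<rparr>"
proof -
  define R1 where "R1 = sym_diff {e \<in> R. fst e \<noteq> a \<and> snd e \<noteq> a} {(u, b), (b, u)}"
  have 1: "vertex_minor \<lparr>pverts = V, parcs = R\<rparr> \<lparr>pverts = V - {a}, parcs = R1\<rparr>"
    unfolding R1_def using assms by (intro suppress_vertex) auto
  have 2: "vertex_minor \<lparr>pverts = V - {a}, parcs = R1\<rparr>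
    \<lparr>pverts = V - {a} - {b},
     parcs = sym_diff {e \<in> R1. fst e \<noteq> b \<and> snd e \<noteq> b} {(u, v), (v, u)}\<rparr>"
    using assms by (intro suppress_vertex) (auto simp: R1_def)
  have 3: "{e \<in> R1. fst e \<noteq> b \<and> snd e \<noteq> b} = {e \<in> R. fst e \<notin> {a, b} \<and> snd e \<notin> {a, b}}"
    by (auto simp: R1_def)
  have 4: "V - {a} - {b} = V - {a, b}" by auto
  show ?thesis using vertex_minor_trans[OF 1 2] unfolding 3 4 .
qed

text \<open>Suppressing \<open>c\<close> first leaves a path with the two inner vertices
  \<open>a\<close> and \<open>b\<close>.\<close>

lemma suppress_path3:
  assumes "a \<in> V" "b \<in> V" "c \<in> V" "distinct [a, b, c, u, v]"
    and a: "\<And>z. (a, z) \<in> R \<longleftrightarrow> z = u \<or> z = b" "\<And>z. (z, a) \<in> R \<longleftrightarrow> z = u \<or> z = b"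
    and b: "\<And>z. (b, z) \<in> R \<longleftrightarrow> z = a \<or> z = c" "\<And>z. (z, b) \<in> R \<longleftrightarrow> z = a \<or> z = c"
    and c: "\<And>z. (c, z) \<in> R \<longleftrightarrow> z = b \<or> z = v" "\<And>z. (z, c) \<in> R \<longleftrightarrow> z = b \<or> z = v"
  shows "vertex_minor \<lparr>pverts = V, parcs = R\<rparr>
    \<lparr>pverts = V - {a, b, c},
     parcs = sym_diff {e \<in> R. fst e \<notin> {a, b, c} \<and> snd e \<notin> {a, b, c}} {(u, v), (v, u)}\<rparr>"
proof -
  define R1 where "R1 = sym_diff {e \<in> R. fst e \<noteq> c \<and> snd e \<noteq> c} {(b, v), (v, b)}"
  have 1: "vertex_minor \<lparr>pverts = V, parcs = R\<rparr> \<lparr>pverts = V - {c}, parcs = R1\<rparr>"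
    unfolding R1_def using assms by (intro suppress_vertex) auto
  have 2: "vertex_minor \<lparr>pverts = V - {c}, parcs = R1\<rparr>
    \<lparr>pverts = V - {c} - {a, b},
     parcs = sym_diff {e \<in> R1. fst e \<notin> {a, b} \<and> snd e \<notin> {a, b}} {(u, v), (v, u)}\<rparr>"
    using assms by (intro suppress_path2) (auto simp: R1_def)
  have 3: "{e \<in> R1. fst e \<notin> {a, b} \<and> snd e \<notin> {a, b}} =
      {e \<in> R. fst e \<notin> {a, b, c} \<and> snd e \<notin> {a, b, c}}"
    by (auto simp: R1_def)
  have 4: "V - {c} - {a, b} = V - {a, b, c}" by auto
  show ?thesis using vertex_minor_trans[OF 1 2] unfolding 3 4 .
qed

lemma vertex_minor_induced:
  assumes "finite V" "Z \<subseteq> V"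
  shows "vertex_minor \<lparr>pverts = V, parcs = R\<rparr>
    \<lparr>pverts = Z, parcs = {e \<in> R. fst e \<notin> V - Z \<and> snd e \<notin> V - Z}\<rparr>"
proof -
  have "vertex_minor \<lparr>pverts = V, parcs = R\<rparr>
    \<lparr>pverts = V - D, parcs = {e \<in> R. fst e \<notin> D \<and> snd e \<notin> D}\<rparr>" if "finite D" "D \<subseteq> V" for D
    using that
  proof (induction D)
    case empty
    then show ?case by (simp add: vertex_minor.refl)
  next
    case (insert x D)
    let ?H = "\<lparr>pverts = V - D, parcs = {e \<in> R. fst e \<notin> D \<and> snd e \<notin> D}\<rparr>"
    have "vertex_minor \<lparr>pverts = V, parcs = R\<rparr> (delete_vertex ?H x)"
      using insert by (intro vertex_minor.delete_vertex) auto
    moreover have "delete_vertex ?H x =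
      \<lparr>pverts = V - insert x D, parcs = {e \<in> R. fst e \<notin> insert x D \<and> snd e \<notin> insert x D}\<rparr>"
      by (auto simp: delete_vertex_def)
    ultimately show ?case by simp
  qed
  from this[of "V - Z"] show ?thesis
    using assms by (simp add: double_diff)
qed

definition edge_arcs :: "'v set set \<Rightarrow> ('v \<times> 'v) set" where
  "edge_arcs F = {(x, y). x \<noteq> y \<and> {x, y} \<in> F}"

lemma edge_arcs_insert:
  assumes "u \<noteq> v" "{u, v} \<notin> F"
  shows "edge_arcs (insert {u, v} F) = sym_diff (edge_arcs F) {(u, v), (v, u)}"
  using assms by (auto simp: edge_arcs_def doubleton_eq_iff insert_commute)

text \<open>
  Here \<open>M\<close> is the number of pairs of a \<open>k\<close>-set and \<open>e\<close> the number of adjacent ones. The estimate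
  on \<open>e\<close> is one short for \<open>k = 4\<close>, \<open>e = 4\<close>, \<open>q = 33\<close> and \<open>k = 5\<close>, \<open>e = 6\<close>, \<open>q = 55\<close>, which are not
  prime powers, and up to two short for a triangle (\<open>k = e = 3\<close>) with \<open>q = 16, 17\<close>.
\<close>
lemma path_budget:
  fixes k M e q :: nat
  assumes "2 * M + k = k * k" "e \<le> M" "4 * e \<le> M + 3 * k" "5 * M + 2 * k \<le> q + 5"
    and "q \<noteq> 33" "q \<noteq> 55" "\<not> (k = 3 \<and> e = 3)"
  shows "2 * k + 4 * M + 2 * e \<le> q + 6"
proof (cases "k \<ge> 7")
  case True
  \<comment> \<open>Since \<open>5 * M + 2 * k \<le> q + 5\<close>, it is enough that
    \<open>2 * e \<le> M + 1\<close>. By the bound on \<open>4 * e\<close> this follows from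
    \<open>3 * k \<le> M\<close>, which holds from \<open>k = 7\<close> on.\<close>
  then have "7 * k \<le> k * k" by simp
  then show ?thesis using assms by linarith
next
  case False
  then have "k \<in> {0, 1, 2, 3, 4, 5, 6}" by auto
  then show ?thesis using assms by (elim insertE emptyE; simp; presburger)
qed

section \<open>Polarities of finite projective planes\<close>

text \<open>Here \<open>perp z x\<close> says that \<open>z\<close> lies on the polar line of
  \<open>x\<close>; points on their own polar line are allowed. The size of a line enters only as
  the lower bound q + 1, which is what a greedy choice on the line uses.\<close>

locale polarity_plane =
  fixes P :: "'p set" and perp :: "'p \<Rightarrow> 'p \<Rightarrow> bool" and q :: nat
  assumes finite_points: "finite P"
    and perp_sym: "perp x y \<Longrightarrow> perp y x"
    and ex1_perp: "\<lbrakk>x \<in> P; y \<in> P; x \<noteq> y\<rbrakk> \<Longrightarrow> \<exists>!z. z \<in> P \<and> perp z x \<and> perp z y"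
    and card_polar: "x \<in> P \<Longrightarrow> q < card {z \<in> P. perp z x}"
begin

lemma perp_commute: "perp x y \<longleftrightarrow> perp y x"
  using perp_sym by blast

text \<open>The intersection of the polar lines of \<open>x\<close> and \<open>y\<close>, or dually
  the pole of the line joining \<open>x\<close> and \<open>y\<close>.\<close>

definition meet :: "'p \<Rightarrow> 'p \<Rightarrow> 'p" where
  "meet x y = (THE z. z \<in> P \<and> perp z x \<and> perp z y)"

lemma meet:
  assumes "x \<in> P" "y \<in> P" "x \<noteq> y"
  shows "meet x y \<in> P" "perp (meet x y) x" "perp (meet x y) y"
  using theI'[OF ex1_perp[OF assms]] unfolding meet_def by simp_all

lemma meet_eq:
  assumes "x \<in> P" "y \<in> P" "x \<noteq> y" "z \<in> P" "perp z x" "perp z y"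
  shows "z = meet x y"
  unfolding meet_def using the1_equality[OF ex1_perp[OF assms(1-3)]] assms(4-6) by simp

section \<open>Greedy choice of connecting paths\<close>

lemma ex_polar_avoiding:
  assumes "u \<in> P" "finite B" "card B \<le> q"
  obtains a where "a \<in> P" "perp a u" "a \<notin> B"
proof -
  have "\<not> {z \<in> P. perp z u} \<subseteq> B"
    using card_polar[OF assms(1)] card_mono[OF assms(2), of "{z \<in> P. perp z u}"] assms(3)
    by linarith
  then show ?thesis using that by blast
qed

text \<open>Once \<open>a\<close> is chosen on the polar line of \<open>u\<close>, the point
  \<open>b\<close> is forced, so every requirement becomes a condition on \<open>a\<close>. Each
  point of \<open>Z\<close> other than \<open>u\<close> excludes at most one choice on account of
  \<open>a\<close>, and each one other than \<open>v\<close> at most one on account of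
  \<open>b\<close>: together at most \<open>2 * card Z - 2 \<le> q\<close>.\<close>

lemma path2_exists:
  assumes Z: "Z \<subseteq> P" "u \<in> Z" "v \<in> Z" "u \<noteq> v" "\<not> perp u v"
    and card: "2 * card Z \<le> q + 2"
  obtains a b where "a \<in> P - Z" "b \<in> P - Z" "a \<noteq> b" "perp a b"
    "\<And>z. z \<in> Z \<Longrightarrow> perp a z \<longleftrightarrow> z = u" "\<And>z. z \<in> Z \<Longrightarrow> perp b z \<longleftrightarrow> z = v"
proof -
  have fin: "finite Z" using Z(1) finite_points finite_subset by blast
  \<comment> \<open>If \<open>b = meet a v\<close> is orthogonal to \<open>z\<close>, then \<open>b = meet v z\<close> and hence \<open>a = meet u (meet v z)\<close>.\<close>
  define B where "B = meet u ` (Z - {u}) \<union> (\<lambda>z. meet u (meet v z)) ` (Z - {v})"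
  have "card B \<le> card (Z - {u}) + card (Z - {v})"
    unfolding B_def using fin
    by (intro order.trans[OF card_Un_le] add_mono card_image_le) auto
  then have "card B \<le> q" "finite B"
    using card Z fin by (auto simp: B_def card_Diff_singleton)
  moreover have uP: "u \<in> P" "v \<in> P" using Z by auto
  ultimately obtain a where a: "a \<in> P" "perp a u" "a \<notin> B"
    using ex_polar_avoiding by metis
  have az: "z = u" if "z \<in> Z" "perp a z" for z
    using meet_eq[of u z a] a that Z(1) uP by (auto simp: B_def)
  have "a \<noteq> v" using a(2) Z(5) perp_sym by blast
  define b where "b = meet a v"
  have b: "b \<in> P" "perp b a" "perp b v"
    using meet[of a v] a uP \<open>a \<noteq> v\<close> by (auto simp: b_def)
  have bz: "z = v" if z: "z \<in> Z" "perp b z" for z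
  proof (rule ccontr)
    assume "z \<noteq> v"
    then have beq: "b = meet v z"
      using meet_eq[of v z b] b z Z(1) uP by auto
    have "b \<noteq> u" using b(3) Z(5) by blast
    then have "a = meet u b"
      using meet_eq[of u b a] a b uP perp_sym by blast
    then show False using a(3) beq z \<open>z \<noteq> v\<close> by (auto simp: B_def)
  qed
  \<comment> \<open>Avoiding \<open>Z\<close> comes for free: \<open>a\<close> and \<open>b\<close>
    are orthogonal to each other, so \<open>a \<in> Z\<close> would force \<open>a = v\<close>, and
    \<open>b \<in> Z\<close> would force \<open>b = u\<close>, making \<open>u\<close> and
    \<open>v\<close> orthogonal.\<close>
  have "a \<notin> Z" using bz[of a] b(2) \<open>a \<noteq> v\<close> by blast
  moreover have "b \<notin> Z" using az[of b] b Z(5) perp_sym by blast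
  moreover have "a \<noteq> b" using az[of v] b(3) Z by blast
  ultimately show ?thesis
    using that[of a b] a b az bz perp_sym by blast
qed

text \<open>
  Second neighbors \<open>z\<close> of \<open>v\<close> forbid nothing new in the choice of \<open>c \<in> v\<^sup>\<bottom>\<close>: the point \<open>meet v z\<close> lies in
  \<open>Z\<close>, which \<open>c\<close> avoids anyway. This saving is only needed when \<open>K\<close> is a triangle.
\<close>
definition second_neighbors :: "'p set \<Rightarrow> 'p \<Rightarrow> 'p set" where
  "second_neighbors Z v = {z \<in> Z - {v}. \<exists>y\<in>Z. perp y v \<and> perp y z}"

lemma meet_second_neighbors:
  assumes "Z \<subseteq> P" "v \<in> Z" "z \<in> second_neighbors Z v"
  shows "meet v z \<in> Z"
  using assms meet_eq[of v z] unfolding second_neighbors_def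
  by (smt (verit) DiffE insertCI mem_Collect_eq subsetD)

text \<open>Two choices are free, first \<open>a\<close> and then \<open>c\<close>; the middle point
  \<open>b\<close> is forced by them. The tight count is the one for \<open>c\<close>: at most
  \<open>2 * card Z\<close> points of the polar line of \<open>v\<close> are excluded, less the
  second neighbors of \<open>v\<close>.\<close>

lemma path3_exists:
  assumes Z: "Z \<subseteq> P" "u \<in> Z" "v \<in> Z" "u \<noteq> v" "perp u v"
    and card: "2 * card Z \<le> q + card (second_neighbors Z u)"
      "2 * card Z \<le> q + card (second_neighbors Z v)"
  obtains a b c where "a \<in> P - Z" "b \<in> P - Z" "c \<in> P - Z" "distinct [a, b, c]"
    "perp a b" "perp b c" "\<not> perp a c"
    "\<And>z. z \<in> Z \<Longrightarrow> perp a z \<longleftrightarrow> z = u" "\<And>z. z \<in> Z \<Longrightarrow> \<not> perp b z"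
    "\<And>z. z \<in> Z \<Longrightarrow> perp c z \<longleftrightarrow> z = v"
proof -
  have fin: "finite Z" using Z(1) finite_points finite_subset by blast
  have uP: "u \<in> P" "v \<in> P" using Z by auto
  have sub: "second_neighbors Z x \<subseteq> Z - {x}" for x
    by (auto simp: second_neighbors_def)
  have cardD: "card (Z - {x} - second_neighbors Z x) + card (second_neighbors Z x) + 1 = card Z"
    if "x \<in> Z" for x
  proof -
    have "card (Z - {x} - second_neighbors Z x) + card (second_neighbors Z x) = card (Z - {x})"
      using sub[of x] fin
      by (metis card_Diff_subset card_mono finite_Diff finite_subset le_add_diff_inverse2)
    then show ?thesis using that fin by (metis Suc_eq_plus1 card_Suc_Diff1)
  qed
  define A where "A = meet u ` (Z - {u} - second_neighbors Z u) \<union> Z"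
  have "card A \<le> card (Z - {u} - second_neighbors Z u) + card Z"
    unfolding A_def using fin
    by (intro order.trans[OF card_Un_le] add_mono card_image_le) auto
  then have "card A \<le> q" "finite A"
    using card(1) cardD[OF Z(2)] fin by (auto simp: A_def)
  then obtain a where a: "a \<in> P" "perp a u" "a \<notin> A"
    using ex_polar_avoiding uP by metis
  have az: "z = u" if "z \<in> Z" "perp a z" for z
    using meet_eq[of u z a] meet_second_neighbors[of Z u z] a that Z uP
    by (auto simp: A_def)
  have "a \<notin> Z" using a(3) by (simp add: A_def)
  have nav: "\<not> perp a v" using az[of v] Z by blast
  \<comment> \<open>Excluding \<open>meet v a\<close> keeps \<open>a\<close> and \<open>c\<close>
    nonadjacent, so that the path is induced. The last set handles \<open>b\<close>: if
    \<open>b\<close> is orthogonal to \<open>z\<close>, then \<open>b = meet a z\<close> and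
    \<open>c = meet v b\<close>.\<close>
  define B where "B = insert (meet v a) (meet v ` (Z - {v} - second_neighbors Z v)) \<union>
    (\<lambda>z. meet v (meet a z)) ` Z"
  have "card B \<le> (card (Z - {v} - second_neighbors Z v) + 1) + card Z"
    unfolding B_def using fin
    by (intro order.trans[OF card_Un_le] add_mono card_image_le order.trans[OF card_insert_le_m1])
      (auto intro!: card_image_le)
  then have "card B \<le> q" "finite B"
    using card(2) cardD[OF Z(3)] fin by (auto simp: B_def)
  then obtain c where c: "c \<in> P" "perp c v" "c \<notin> B"
    using ex_polar_avoiding uP by metis
  have "a \<noteq> v" using \<open>a \<notin> Z\<close> Z by blast
  have nac: "\<not> perp a c"
    using meet_eq[of v a c] a c uP \<open>a \<noteq> v\<close> perp_sym unfolding B_def by blast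
  have "a \<noteq> c" using c nav by blast
  define b where "b = meet a c"
  have b: "b \<in> P" "perp b a" "perp b c"
    using meet[of a c] a c \<open>a \<noteq> c\<close> by (auto simp: b_def)
  have bz: False if z: "z \<in> Z" "perp b z" for z
  proof -
    have "z \<noteq> a" using z \<open>a \<notin> Z\<close> by blast
    then have beq: "b = meet a z"
      using meet_eq[of a z b] b z Z(1) a by auto
    have "b \<noteq> v" using b(2) nav perp_sym by blast
    then have "c = meet v b"
      using meet_eq[of v b c] c b uP perp_sym by blast
    then show False using c(3) beq z by (auto simp: B_def)
  qed
  \<comment> \<open>\<open>b\<close> is orthogonal to \<open>c\<close> but to nothing in
    \<open>Z\<close>. This must precede the claim on neighbors of \<open>c\<close>, where a second
    neighbor \<open>z\<close> of \<open>v\<close> would put \<open>c = meet v z\<close> into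
    \<open>Z\<close>.\<close>
  have "c \<notin> Z" using bz[of c] b(3) by blast
  have cz: "z = v" if "z \<in> Z" "perp c z" for z
  proof (rule ccontr)
    assume "z \<noteq> v"
    then have "c = meet v z" using meet_eq[of v z c] c that Z(1) uP by auto
    then show False
      using meet_second_neighbors[of Z v z] \<open>c \<notin> Z\<close> \<open>z \<noteq> v\<close> c(3) that Z
      by (auto simp: B_def)
  qed
  have "b \<notin> Z"
    using az[of b] cz[of b] b perp_sym Z(4) by blast
  moreover have "a \<noteq> b" "b \<noteq> c" using b nac perp_sym by blast+
  ultimately show ?thesis
  proof (intro that)
    show "perp a b" using b(2) by (rule perp_sym)
    show "perp a z \<longleftrightarrow> z = u" if "z \<in> Z" for z using az that a(2) by blast
    show "perp c z \<longleftrightarrow> z = v" if "z \<in> Z" for z using cz that c(2) by blast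
  qed (use a b c bz nac \<open>a \<notin> Z\<close> \<open>c \<notin> Z\<close> \<open>a \<noteq> c\<close> in simp_all, blast)
qed

section \<open>Toggling pairs of \<open>K\<close> by gadgets, with arbitrary arcs inside
  \<open>K\<close>\<close>

definition hybrid :: "'p set \<Rightarrow> ('p \<times> 'p) set \<Rightarrow> 'p set \<Rightarrow> 'p pair_pre_digraph" where
  "hybrid K E Z = \<lparr>pverts = Z,
     parcs = E \<union> {(x, y). x \<in> Z \<and> y \<in> Z \<and> x \<noteq> y \<and> perp x y \<and> \<not> (x \<in> K \<and> y \<in> K)}\<rparr>"

text \<open>
  Letting the arcs inside \<open>K\<close> be arbitrary makes the property stable under adding further
  gadgets: suppressing a gadget changes nothing but these arcs.
\<close>
definition toggles :: "'p set \<Rightarrow> 'p set \<Rightarrow> 'p set set \<Rightarrow> bool" where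
  "toggles K Z F \<longleftrightarrow> (\<forall>E \<subseteq> K \<times> K.
     vertex_minor (hybrid K E Z) \<lparr>pverts = K, parcs = sym_diff E (edge_arcs F)\<rparr>)"

lemma toggles_empty: "toggles K K {}"
proof -
  have "hybrid K E K = \<lparr>pverts = K, parcs = E\<rparr>" for E
    by (auto simp: hybrid_def)
  then show ?thesis by (simp add: toggles_def edge_arcs_def vertex_minor.refl)
qed

text \<open>The newest gadget is suppressed first. It only replaces \<open>E\<close> by
  \<open>E\<close> with one pair toggled, and the older gadgets work for this new \<open>E\<close>
  as well.\<close>

lemma toggles_insert:
  assumes "toggles K Z F" "u \<in> K" "v \<in> K" "u \<noteq> v" "{u, v} \<notin> F"
    and step: "\<And>E. E \<subseteq> K \<times> K \<Longrightarrow> vertex_minor (hybrid K E Z')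
      \<lparr>pverts = Z, parcs = sym_diff (parcs (hybrid K E Z)) {(u, v), (v, u)}\<rparr>"
  shows "toggles K Z' (insert {u, v} F)"
  unfolding toggles_def
proof (intro allI impI)
  fix E assume E: "E \<subseteq> K \<times> K"
  define E' where "E' = sym_diff E {(u, v), (v, u)}"
  have "\<lparr>pverts = Z, parcs = sym_diff (parcs (hybrid K E Z)) {(u, v), (v, u)}\<rparr> = hybrid K E' Z"
    using assms(2,3) by (auto simp: hybrid_def E'_def)
  with step[OF E] have 1: "vertex_minor (hybrid K E Z') (hybrid K E' Z)" by simp
  have "E' \<subseteq> K \<times> K" using E assms(2,3) by (auto simp: E'_def)
  then have 2: "vertex_minor (hybrid K E' Z) \<lparr>pverts = K, parcs = sym_diff E' (edge_arcs F)\<rparr>"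
    using assms(1) by (auto simp: toggles_def)
  have 3: "sym_diff E' (edge_arcs F) = sym_diff E (edge_arcs (insert {u, v} F))"
    unfolding edge_arcs_insert[OF assms(4,5)] E'_def by blast
  show "vertex_minor (hybrid K E Z')
    \<lparr>pverts = K, parcs = sym_diff E (edge_arcs (insert {u, v} F))\<rparr>"
    using vertex_minor_trans[OF 1 2] unfolding 3 .
qed

text \<open>In the enlarged hybrid graph \<open>a\<close> and \<open>b\<close> have only their
  neighbors on the path, even if they are self-orthogonal, because arcs leaving \<open>K\<close>
  join distinct points. Removing both gives back the hybrid graph on \<open>Z\<close>.\<close>

lemma toggles_path2:
  assumes "toggles K Z F" "u \<in> K" "v \<in> K" "u \<noteq> v" "{u, v} \<notin> F" "K \<subseteq> Z"
    and ab: "a \<notin> Z" "b \<notin> Z" "a \<noteq> b" "perp a b"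
    and a: "\<And>z. z \<in> Z \<Longrightarrow> perp a z \<longleftrightarrow> z = u"
    and b: "\<And>z. z \<in> Z \<Longrightarrow> perp b z \<longleftrightarrow> z = v"
  shows "toggles K (Z \<union> {a, b}) (insert {u, v} F)"
proof (rule toggles_insert[OF assms(1-5)])
  fix E assume E: "E \<subseteq> K \<times> K"
  define R where "R = parcs (hybrid K E (Z \<union> {a, b}))"
  have uv: "u \<in> Z" "v \<in> Z" using assms by auto
  have R: "(x, y) \<in> R \<longleftrightarrow> (x, y) \<in> E \<or> (x \<in> Z \<union> {a, b} \<and> y \<in> Z \<union> {a, b} \<and> x \<noteq> y \<and>
    perp x y \<and> \<not> (x \<in> K \<and> y \<in> K))" for x y
    by (auto simp: R_def hybrid_def)
  have out: "a \<notin> K" "b \<notin> K" and nE: "(a, z) \<notin> E" "(z, a) \<notin> E" "(b, z) \<notin> E" "(z, b) \<notin> E" for z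
    using ab assms(6) E by auto
  have "a \<noteq> u" "a \<noteq> v" "b \<noteq> u" "b \<noteq> v" using uv ab by auto
  have ra: "(a, z) \<in> R \<longleftrightarrow> z = u \<or> z = b" for z
    unfolding R using out nE ab uv a[of z] by auto
  have rb: "(b, z) \<in> R \<longleftrightarrow> z = a \<or> z = v" for z
    unfolding R using out nE ab uv b[of z] perp_commute[of b a] by auto
  have sym: "(z, a) \<in> R \<longleftrightarrow> (a, z) \<in> R" "(z, b) \<in> R \<longleftrightarrow> (b, z) \<in> R" for z
    unfolding R using out nE perp_commute[of z a] perp_commute[of z b] by auto
  have "vertex_minor \<lparr>pverts = Z \<union> {a, b}, parcs = R\<rparr>
    \<lparr>pverts = Z \<union> {a, b} - {a, b},
     parcs = sym_diff {e \<in> R. fst e \<notin> {a, b} \<and> snd e \<notin> {a, b}} {(u, v), (v, u)}\<rparr>"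
    using \<open>a \<noteq> u\<close> \<open>a \<noteq> v\<close> \<open>b \<noteq> u\<close> \<open>b \<noteq> v\<close> \<open>a \<noteq> b\<close> \<open>u \<noteq> v\<close>
    by (intro suppress_path2) (simp_all add: ra rb sym)
  moreover have "Z \<union> {a, b} - {a, b} = Z" using ab by auto
  moreover have "{e \<in> R. fst e \<notin> {a, b} \<and> snd e \<notin> {a, b}} = parcs (hybrid K E Z)"
    using ab nE by (auto simp: R hybrid_def)
  moreover have "hybrid K E (Z \<union> {a, b}) = \<lparr>pverts = Z \<union> {a, b}, parcs = R\<rparr>"
    by (simp add: R_def hybrid_def)
  ultimately show "vertex_minor (hybrid K E (Z \<union> {a, b}))
      \<lparr>pverts = Z, parcs = sym_diff (parcs (hybrid K E Z)) {(u, v), (v, u)}\<rparr>"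
    by simp
qed

lemma toggles_path3:
  assumes "toggles K Z F" "u \<in> K" "v \<in> K" "u \<noteq> v" "{u, v} \<notin> F" "K \<subseteq> Z"
    and abc: "a \<notin> Z" "b \<notin> Z" "c \<notin> Z" "distinct [a, b, c]" "perp a b" "perp b c" "\<not> perp a c"
    and a: "\<And>z. z \<in> Z \<Longrightarrow> perp a z \<longleftrightarrow> z = u"
    and b: "\<And>z. z \<in> Z \<Longrightarrow> \<not> perp b z"
    and c: "\<And>z. z \<in> Z \<Longrightarrow> perp c z \<longleftrightarrow> z = v"
  shows "toggles K (Z \<union> {a, b, c}) (insert {u, v} F)"
proof (rule toggles_insert[OF assms(1-5)])
  fix E assume E: "E \<subseteq> K \<times> K"
  define R where "R = parcs (hybrid K E (Z \<union> {a, b, c}))"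
  have uv: "u \<in> Z" "v \<in> Z" using assms by auto
  have R: "(x, y) \<in> R \<longleftrightarrow> (x, y) \<in> E \<or> (x \<in> Z \<union> {a, b, c} \<and> y \<in> Z \<union> {a, b, c} \<and> x \<noteq> y \<and>
    perp x y \<and> \<not> (x \<in> K \<and> y \<in> K))" for x y
    by (auto simp: R_def hybrid_def)
  have out: "a \<notin> K" "b \<notin> K" "c \<notin> K"
    and nE: "(a, z) \<notin> E" "(z, a) \<notin> E" "(b, z) \<notin> E" "(z, b) \<notin> E" "(c, z) \<notin> E" "(z, c) \<notin> E" for z
    using abc assms(6) E by auto
  have ne: "a \<noteq> u" "a \<noteq> v" "b \<noteq> u" "b \<noteq> v" "c \<noteq> u" "c \<noteq> v" using uv abc by auto
  have ra: "(a, z) \<in> R \<longleftrightarrow> z = u \<or> z = b" for z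
    unfolding R using out nE abc uv a[of z] by auto
  have rb: "(b, z) \<in> R \<longleftrightarrow> z = a \<or> z = c" for z
    unfolding R using out nE abc uv b[of z] perp_commute[of b a] by auto
  have rc: "(c, z) \<in> R \<longleftrightarrow> z = b \<or> z = v" for z
    unfolding R using out nE abc uv c[of z] perp_commute[of c b] perp_commute[of c a] by auto
  have sym: "(z, a) \<in> R \<longleftrightarrow> (a, z) \<in> R" "(z, b) \<in> R \<longleftrightarrow> (b, z) \<in> R" "(z, c) \<in> R \<longleftrightarrow> (c, z) \<in> R" for z
    unfolding R using out nE perp_commute[of z a] perp_commute[of z b] perp_commute[of z c] by auto
  have "vertex_minor \<lparr>pverts = Z \<union> {a, b, c}, parcs = R\<rparr>
    \<lparr>pverts = Z \<union> {a, b, c} - {a, b, c},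
     parcs = sym_diff {e \<in> R. fst e \<notin> {a, b, c} \<and> snd e \<notin> {a, b, c}} {(u, v), (v, u)}\<rparr>"
    using ne abc(4) \<open>u \<noteq> v\<close>
    by (intro suppress_path3) (simp_all add: ra rb rc sym)
  moreover have "Z \<union> {a, b, c} - {a, b, c} = Z" using abc by auto
  moreover have "{e \<in> R. fst e \<notin> {a, b, c} \<and> snd e \<notin> {a, b, c}} = parcs (hybrid K E Z)"
    using abc nE by (auto simp: R hybrid_def)
  moreover have "hybrid K E (Z \<union> {a, b, c}) = \<lparr>pverts = Z \<union> {a, b, c}, parcs = R\<rparr>"
    by (simp add: R_def hybrid_def)
  ultimately show "vertex_minor (hybrid K E (Z \<union> {a, b, c}))
      \<lparr>pverts = Z, parcs = sym_diff (parcs (hybrid K E Z)) {(u, v), (v, u)}\<rparr>"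
    by simp
qed

text \<open>Every gadget adds two vertices, so the last one is chosen with
  \<open>card K + 2 * (card F - 1)\<close> vertices in use. Inserting this into the bound of
  \<open>path2_exists\<close> gives the last hypothesis.\<close>

lemma toggle_nonadjacent:
  assumes "finite F" "K \<subseteq> P"
    and "\<And>e. e \<in> F \<Longrightarrow> \<exists>u\<in>K. \<exists>v\<in>K. u \<noteq> v \<and> e = {u, v} \<and> \<not> perp u v"
    and "2 * card K + 4 * card F \<le> q + 6"
  shows "\<exists>Z. K \<subseteq> Z \<and> Z \<subseteq> P \<and> card Z = card K + 2 * card F \<and> toggles K Z F"
  using assms(1,3,4)
proof (induction F)
  case empty
  then show ?case using toggles_empty assms(2) by auto
next
  case (insert e F)
  then obtain Z where Z: "K \<subseteq> Z" "Z \<subseteq> P" "card Z = card K + 2 * card F" "toggles K Z F"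
    by auto
  obtain u v where uv: "u \<in> K" "v \<in> K" "u \<noteq> v" "e = {u, v}" "\<not> perp u v"
    using insert.prems(1) by blast
  have "2 * card Z \<le> q + 2" using insert.prems(2) insert.hyps Z(3) by simp
  then obtain a b where ab: "a \<in> P - Z" "b \<in> P - Z" "a \<noteq> b" "perp a b"
    "\<And>z. z \<in> Z \<Longrightarrow> perp a z \<longleftrightarrow> z = u" "\<And>z. z \<in> Z \<Longrightarrow> perp b z \<longleftrightarrow> z = v"
    using path2_exists[of Z u v] Z uv by blast
  have "finite Z" using Z(2) finite_points finite_subset by blast
  then have "card (Z \<union> {a, b}) = card K + 2 * card (insert e F)"
    using ab(1-3) Z(3) insert.hyps by simp
  moreover have "toggles K (Z \<union> {a, b}) (insert e F)"
    unfolding uv(4) using ab insert.hyps uv Z by (intro toggles_path2) auto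
  ultimately show ?case using Z ab(1,2) by (intro exI[of _ "Z \<union> {a, b}"]) auto
qed

lemma card_second_neighbors_mono:
  assumes "K \<subseteq> Z" "finite Z"
  shows "card (second_neighbors K u) \<le> card (second_neighbors Z u)"
  using assms by (intro card_mono) (auto simp: second_neighbors_def)

text \<open>The last gadget finds \<open>card Z0 + 3 * (card F - 1)\<close> vertices in use, which
  explains the budget. Second neighbors within \<open>K\<close> remain second neighbors as
  \<open>Z\<close> grows, so the gain \<open>s\<close> is available at every step.\<close>

lemma toggle_adjacent:
  assumes "finite F" "toggles K Z0 F0" "K \<subseteq> Z0" "Z0 \<subseteq> P"
    and "F \<inter> F0 = {}"
    and "\<And>e. e \<in> F \<Longrightarrow> \<exists>u\<in>K. \<exists>v\<in>K. u \<noteq> v \<and> e = {u, v} \<and> perp u v"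
    and s: "\<And>u. u \<in> K \<Longrightarrow> s \<le> card (second_neighbors K u)"
    and "2 * card Z0 + 6 * card F \<le> q + 6 + s"
  shows "\<exists>Z. K \<subseteq> Z \<and> Z \<subseteq> P \<and> card Z = card Z0 + 3 * card F \<and> toggles K Z (F \<union> F0)"
  using assms(1,5,6,8)
proof (induction F)
  case empty
  then show ?case using assms by auto
next
  case (insert e F)
  then obtain Z where Z: "K \<subseteq> Z" "Z \<subseteq> P" "card Z = card Z0 + 3 * card F" "toggles K Z (F \<union> F0)"
    by auto
  obtain u v where uv: "u \<in> K" "v \<in> K" "u \<noteq> v" "e = {u, v}" "perp u v"
    using insert.prems(2) by blast
  have fin: "finite Z" using Z(2) finite_points finite_subset by blast
  have "2 * card Z \<le> q + s" using insert.prems(3) insert.hyps Z(3) by simp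
  moreover have "s \<le> card (second_neighbors Z u)" "s \<le> card (second_neighbors Z v)"
    using s uv card_second_neighbors_mono[OF Z(1) fin] order.trans by blast+
  ultimately have "2 * card Z \<le> q + card (second_neighbors Z u)"
    "2 * card Z \<le> q + card (second_neighbors Z v)" by linarith+
  then obtain a b c where abc: "a \<in> P - Z" "b \<in> P - Z" "c \<in> P - Z" "distinct [a, b, c]"
    "perp a b" "perp b c" "\<not> perp a c"
    "\<And>z. z \<in> Z \<Longrightarrow> perp a z \<longleftrightarrow> z = u" "\<And>z. z \<in> Z \<Longrightarrow> \<not> perp b z"
    "\<And>z. z \<in> Z \<Longrightarrow> perp c z \<longleftrightarrow> z = v"
    using path3_exists[of Z u v] Z uv by blast
  have "card (Z \<union> {a, b, c}) = card Z0 + 3 * card (insert e F)"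
    using abc(1-4) Z(3) insert.hyps fin by simp
  moreover have "toggles K (Z \<union> {a, b, c}) (insert e F \<union> F0)"
    unfolding uv(4) Un_insert_left using abc insert.hyps insert.prems(1) uv Z
    by (intro toggles_path3) auto
  ultimately show ?case using Z abc(1-3) by (intro exI[of _ "Z \<union> {a, b, c}"]) auto
qed

section \<open>Counting adjacent pairs\<close>

definition edges :: "'p set \<Rightarrow> 'p set set" where
  "edges K = {{u, v} | u v. u \<in> K \<and> v \<in> K \<and> u \<noteq> v \<and> perp u v}"

lemma edges_subset: "edges K \<subseteq> {e. e \<subseteq> K \<and> card e = 2}"
  by (auto simp: edges_def)

lemma card_edges_le_choose: "finite K \<Longrightarrow> card (edges K) \<le> card K choose 2"
  using card_mono[OF _ edges_subset[of K]] by (simp add: n_subsets)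

text \<open>Without 4-cycles, each pair in \<open>K\<close> lies in the neighborhood of at most one
  point of \<open>K\<close>. So the sum of \<open>d choose 2\<close> over the degrees
  \<open>d\<close> is at most \<open>card K choose 2\<close>, and a linear lower bound for
  \<open>d choose 2\<close> turns this into a bound on the degree sum.\<close>

lemma card_edges_bound:
  assumes "K \<subseteq> P"
  shows "4 * card (edges K) \<le> (card K choose 2) + 3 * card K"
proof -
  have fin: "finite K" using assms finite_points finite_subset by blast
  define N where "N x = {y \<in> K. y \<noteq> x \<and> perp x y}" for x
  have finN: "finite (N x)" for x using fin by (simp add: N_def)
  have finE: "finite (edges K)"
    using finite_subset[OF edges_subset[of K]] fin by simp
  have deg: "card {e \<in> edges K. x \<in> e} = card (N x)" if "x \<in> K" for x
  proof -
    have "bij_betw (\<lambda>y. {x, y}) (N x) {e \<in> edges K. x \<in> e}"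
      unfolding bij_betw_def
    proof
      show "inj_on (\<lambda>y. {x, y}) (N x)"
        by (auto simp: inj_on_def N_def doubleton_eq_iff)
      show "(\<lambda>y. {x, y}) ` N x = {e \<in> edges K. x \<in> e}"
        using that perp_sym by (fastforce simp: N_def edges_def insert_commute)
    qed
    then show ?thesis by (simp add: bij_betw_same_card)
  qed
  have "{x \<in> K. x \<in> e} = e" if "e \<in> edges K" for e
    using that edges_subset[of K] by blast
  then have "\<forall>e \<in> edges K. card {x \<in> K. x \<in> e} = 2"
    using edges_subset[of K] by auto
  then have handshake: "(\<Sum>x\<in>K. card (N x)) = 2 * card (edges K)"
    using sum_multicount_gen[OF fin finE, of "\<lambda>x e. x \<in> e" "\<lambda>_. 2"] deg by simp
  \<comment> \<open>Two distinct points have only one common neighbor, so the pairs inside the \<open>N x\<close> are distinct.\<close>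
  define Q where "Q x = {B. B \<subseteq> N x \<and> card B = 2}" for x
  have disj: "Q x \<inter> Q x' = {}" if "x \<in> K" "x' \<in> K" "x \<noteq> x'" for x x'
  proof -
    have False if "B \<in> Q x" "B \<in> Q x'" for B
    proof -
      from that obtain y z where "B = {y, z}" "y \<noteq> z"
        by (auto simp: Q_def card_2_iff)
      with that have "y \<in> N x" "z \<in> N x" "y \<in> N x'" "z \<in> N x'" by (auto simp: Q_def)
      then have "x = meet y z" "x' = meet y z"
        using meet_eq[of y z x] meet_eq[of y z x'] \<open>y \<noteq> z\<close> \<open>x \<in> K\<close> \<open>x' \<in> K\<close> assms
        unfolding N_def by blast+
      with \<open>x \<noteq> x'\<close> show False by simp
    qed
    then show ?thesis by blast
  qed
  have "(\<Sum>x\<in>K. card (N x) choose 2) = (\<Sum>x\<in>K. card (Q x))"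
    by (simp add: Q_def n_subsets finN)
  also have "\<dots> = card (\<Union>x\<in>K. Q x)"
    using fin disj finN by (subst card_UN_disjoint) (auto simp: Q_def)
  also have "\<dots> \<le> card {B. B \<subseteq> K \<and> card B = 2}"
    using fin by (intro card_mono) (auto simp: Q_def N_def)
  also have "\<dots> = card K choose 2" using fin by (simp add: n_subsets)
  finally have choose: "(\<Sum>x\<in>K. card (N x) choose 2) \<le> card K choose 2" .
  have *: "2 * d \<le> (d choose 2) + 3" for d
  proof (induction d)
    case (Suc d)
    have "Suc d choose 2 = d + (d choose 2)" by (simp add: numeral_2_eq_2)
    moreover consider "d = 0" | "d = 1" | "d \<ge> 2" by linarith
    ultimately show ?case using Suc by cases auto
  qed simp
  have "4 * card (edges K) = (\<Sum>x\<in>K. 2 * card (N x))"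
    by (simp add: sum_distrib_left[symmetric] handshake)
  also have "\<dots> \<le> (\<Sum>x\<in>K. (card (N x) choose 2) + 3)" by (intro sum_mono *)
  also have "\<dots> = (\<Sum>x\<in>K. card (N x) choose 2) + 3 * card K" by (simp add: sum.distrib)
  finally show ?thesis using choose by linarith
qed

text \<open>In a triangle, each of the two vertices other than \<open>u\<close> is reached from
  \<open>u\<close> through the third.\<close>

lemma card_second_neighbors_triangle:
  assumes "K \<subseteq> P" "card K = 3" "card (edges K) = 3" "u \<in> K"
  shows "2 \<le> card (second_neighbors K u)"
proof -
  have fin: "finite K" using assms(2) by (simp add: card_ge_0_finite)
  have "card {e. e \<subseteq> K \<and> card e = 2} = 3"
    using n_subsets[OF fin, of 2] assms(2) by (simp add: numeral_eq_Suc)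
  then have "edges K = {e. e \<subseteq> K \<and> card e = 2}"
    using edges_subset[of K] fin assms(3) by (intro card_subset_eq) auto
  then have perp: "perp x y" if "x \<in> K" "y \<in> K" "x \<noteq> y" for x y
  proof -
    have "{x, y} \<in> edges K" using that \<open>edges K = _\<close> by simp
    then show ?thesis by (auto simp: edges_def doubleton_eq_iff intro: perp_sym)
  qed
  have "K - {u} \<subseteq> second_neighbors K u"
  proof
    fix z assume z: "z \<in> K - {u}"
    have "card {u, z} = 2" using z by auto
    then have "card (K - {u, z}) = 1" using z assms fin by (simp add: card_Diff_subset)
    then obtain y where "y \<in> K" "y \<noteq> u" "y \<noteq> z"
      by (metis card_1_singletonE Diff_iff insertCI)
    then show "z \<in> second_neighbors K u"
      using perp z assms(4) by (auto simp: second_neighbors_def)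
  qed
  moreover have "card (K - {u}) = 2" using assms fin by simp
  moreover have "finite (second_neighbors K u)" using fin by (simp add: second_neighbors_def)
  ultimately show ?thesis by (metis card_mono)
qed

text \<open>\<open>T\<close> collects the pairs on which \<open>H\<close> and the graph induced on
  \<open>K\<close> differ. Its nonadjacent pairs \<open>F2\<close> receive gadgets with two
  vertices, then its adjacent pairs \<open>F1\<close> gadgets with three; suppressing all of them
  yields \<open>H\<close>.\<close>

lemma vertex_minor_polarity_graph:
  assumes "K \<subseteq> P" "pair_graph H" "pverts H = K"
    and q: "5 * (card K choose 2) + 2 * card K \<le> q + 5" "q \<noteq> 33" "q \<noteq> 55"
  shows "vertex_minor
    \<lparr>pverts = P, parcs = {(x, y). x \<in> P \<and> y \<in> P \<and> x \<noteq> y \<and> perp x y}\<rparr> H"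
proof -
  interpret H: pair_graph H by fact
  have fin: "finite K" using assms(1) finite_points finite_subset by blast
  define E where "E = {(x, y). x \<in> K \<and> y \<in> K \<and> x \<noteq> y \<and> perp x y}"
  define T where "T = {{x, y} | x y. x \<in> K \<and> y \<in> K \<and> x \<noteq> y \<and>
    ((x, y) \<in> E \<longleftrightarrow> (x, y) \<notin> parcs H)}"
  have symE: "(x, y) \<in> E \<longleftrightarrow> (y, x) \<in> E" for x y
    using perp_sym by (auto simp: E_def)
  have symH: "(x, y) \<in> parcs H \<longleftrightarrow> (y, x) \<in> parcs H" for x y
    using H.arcs_symmetric by blast
  have HK: "x \<in> K \<and> y \<in> K \<and> x \<noteq> y" if "(x, y) \<in> parcs H" for x y
    using that assms(3) H.in_arcsD1 H.in_arcsD2 H.no_loops' by blast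
  have "{x, y} \<in> T \<longleftrightarrow> (x, y) \<in> sym_diff E (parcs H)" if "x \<noteq> y" for x y
    using that symE[of x y] symH[of x y] HK[of x y] unfolding T_def E_def
    by (auto simp: doubleton_eq_iff)
  moreover have "x \<noteq> y" if "(x, y) \<in> sym_diff E (parcs H)" for x y
    using that HK by (auto simp: E_def)
  ultimately have T: "edge_arcs T = sym_diff E (parcs H)"
    unfolding edge_arcs_def by auto
  define F1 where "F1 = T \<inter> edges K"
  define F2 where "F2 = T - edges K"
  have finP: "finite {e. e \<subseteq> K \<and> card e = 2}" using fin by simp
  have Tsub: "T \<subseteq> {e. e \<subseteq> K \<and> card e = 2}" by (auto simp: T_def)
  have finE: "finite (edges K)" using edges_subset finP by (rule finite_subset)
  have card1: "card F1 \<le> card (edges K)" using finE by (simp add: F1_def card_mono)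
  have "card F2 \<le> card ({e. e \<subseteq> K \<and> card e = 2} - edges K)"
    using Tsub finP by (intro card_mono) (auto simp: F2_def)
  also have "\<dots> = (card K choose 2) - card (edges K)"
    using finE edges_subset[of K] by (simp add: card_Diff_subset n_subsets fin)
  finally have card2: "card F2 + card (edges K) \<le> card K choose 2"
    using card_edges_le_choose[OF fin] by linarith
  have finF: "finite F1" "finite F2"
    using finE finite_subset[OF Tsub finP] by (auto simp: F1_def F2_def)
  have "2 * card K + 4 * card F2 \<le> q + 6" using q(1) card2 by linarith
  moreover have "\<exists>u\<in>K. \<exists>v\<in>K. u \<noteq> v \<and> e = {u, v} \<and> \<not> perp u v" if "e \<in> F2" for e
    using that unfolding F2_def T_def edges_def by blast
  ultimately obtain Z2 where Z2: "K \<subseteq> Z2" "Z2 \<subseteq> P" "card Z2 = card K + 2 * card F2"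
    "toggles K Z2 F2"
    using toggle_nonadjacent[OF finF(2) assms(1)] by blast
  \<comment> \<open>For a triangle the budget reads \<open>24 \<le> q + 6 + s\<close>, while the
    size hypothesis only gives \<open>16 \<le> q\<close>; the value 2 closes this gap
    exactly.\<close>
  define s :: nat where "s = (if card K = 3 \<and> card (edges K) = 3 then 2 else 0)"
  have M: "2 * (card K choose 2) + card K = card K * card K"
    by (cases "card K") (simp_all add: choose_two algebra_simps)
  \<comment> \<open>The worst case, in which every pair has to be toggled: e adjacent ones among M
    cost 2k + 4(M - e) + 6e.\<close>
  have "2 * card K + 4 * (card K choose 2) + 2 * card (edges K) \<le> q + 6 + s"
  proof (cases "card K = 3 \<and> card (edges K) = 3")
    case True
    then show ?thesis using q(1) M by (simp add: s_def)
  next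
    case False
    then show ?thesis
      using path_budget[OF M card_edges_le_choose[OF fin] card_edges_bound[OF assms(1)] q]
      by (simp add: s_def)
  qed
  then have "2 * card Z2 + 6 * card F1 \<le> q + 6 + s"
    using Z2(3) card1 card2 by linarith
  moreover have "s \<le> card (second_neighbors K u)" if "u \<in> K" for u
    using card_second_neighbors_triangle[OF assms(1) _ _ that] by (simp add: s_def)
  moreover have "\<exists>u\<in>K. \<exists>v\<in>K. u \<noteq> v \<and> e = {u, v} \<and> perp u v" if "e \<in> F1" for e
    using that unfolding F1_def edges_def by blast
  moreover have "F1 \<inter> F2 = {}" by (auto simp: F1_def F2_def)
  ultimately have "\<exists>Z. K \<subseteq> Z \<and> Z \<subseteq> P \<and> card Z = card Z2 + 3 * card F1 \<and>
      toggles K Z (F1 \<union> F2)"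
    by (intro toggle_adjacent[OF finF(1) Z2(4,1,2)])
  then obtain Z where Z: "K \<subseteq> Z" "Z \<subseteq> P" "toggles K Z (F1 \<union> F2)"
    by blast
  have "F1 \<union> F2 = T" by (auto simp: F1_def F2_def)
  have "hybrid K E Z = \<lparr>pverts = Z, parcs = {e \<in> {(x, y). x \<in> P \<and> y \<in> P \<and> x \<noteq> y \<and> perp x y}.
      fst e \<notin> P - Z \<and> snd e \<notin> P - Z}\<rparr>"
    using Z assms(1) by (auto simp: hybrid_def E_def)
  then have 1: "vertex_minor
      \<lparr>pverts = P, parcs = {(x, y). x \<in> P \<and> y \<in> P \<and> x \<noteq> y \<and> perp x y}\<rparr> (hybrid K E Z)"
    using vertex_minor_induced[OF finite_points Z(2),
        of "{(x, y). x \<in> P \<and> y \<in> P \<and> x \<noteq> y \<and> perp x y}"] by (simp only:)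
  have "E \<subseteq> K \<times> K" by (auto simp: E_def)
  then have 2: "vertex_minor (hybrid K E Z) \<lparr>pverts = K, parcs = sym_diff E (edge_arcs T)\<rparr>"
    using Z(3) unfolding \<open>F1 \<union> F2 = T\<close> toggles_def by blast
  have "sym_diff E (edge_arcs T) = parcs H" unfolding T by blast
  then have "\<lparr>pverts = K, parcs = sym_diff E (edge_arcs T)\<rparr> = H"
    using assms(3) by simp
  then show ?thesis using vertex_minor_trans[OF 1 2] by simp
qed

end

section \<open>The orthogonality polarity of \<open>PG(2, q)\<close>\<close>

definition cross :: "'a::field ^ 3 \<Rightarrow> 'a ^ 3 \<Rightarrow> 'a ^ 3" where
  "cross x y = vector [x$2 * y$3 - x$3 * y$2, x$3 * y$1 - x$1 * y$3, x$1 * y$2 - x$2 * y$1]"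

lemma cross_components [simp]:
  "cross x y $ 1 = x$2 * y$3 - x$3 * y$2"
  "cross x y $ 2 = x$3 * y$1 - x$1 * y$3"
  "cross x y $ 3 = x$1 * y$2 - x$2 * y$1"
  by (simp_all add: cross_def)

lemma scalar_product_3: "scalar_product x y = x$1 * y$1 + x$2 * y$2 + x$3 * y$3"
  for x y :: "'a::field ^ 3"
  by (simp add: scalar_product_def sum_3)

lemma vec3_eq_iff: "x = y \<longleftrightarrow> x$1 = y$1 \<and> x$2 = y$2 \<and> x$3 = y$3"
  for x y :: "'a ^ 3"
  by (simp add: vec_eq_iff forall_3)

lemma scalar_product_cross:
  "scalar_product (cross x y) x = 0" "scalar_product (cross x y) y = 0"
  by (simp_all add: scalar_product_3 algebra_simps)

text \<open>The triple product expansion. It shows that a vector orthogonal to \<open>x\<close> and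
  \<open>y\<close> has zero cross product with \<open>cross x y\<close>.\<close>

lemma cross_cross:
  "cross z (cross x y) = scalar_product z y *s x - scalar_product z x *s y"
  by (simp add: vec3_eq_iff scalar_product_3 algebra_simps)

lemma cross_eq_0D:
  assumes "x \<noteq> 0" "cross x y = 0"
  obtains t where "y = t *s x"
proof -
  have c: "x$2 * y$3 = x$3 * y$2" "x$3 * y$1 = x$1 * y$3" "x$1 * y$2 = x$2 * y$1"
    using assms(2) by (simp_all add: vec3_eq_iff)
  consider "x$1 \<noteq> 0" | "x$2 \<noteq> 0" | "x$3 \<noteq> 0"
    using assms(1) by (auto simp: vec3_eq_iff)
  then show ?thesis
  proof cases
    case 1
    then have "y = (y$1 / x$1) *s x" using c by (simp add: vec3_eq_iff field_simps)
    then show ?thesis by (rule that)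
  next
    case 2
    then have "y = (y$2 / x$2) *s x" using c by (simp add: vec3_eq_iff field_simps)
    then show ?thesis by (rule that)
  next
    case 3
    then have "y = (y$3 / x$3) *s x" using c by (simp add: vec3_eq_iff field_simps)
    then show ?thesis by (rule that)
  qed
qed

section \<open>Points as spans of nonzero vectors\<close>

lemma mem_span_singleton: "y \<in> vec.span {x} \<longleftrightarrow> (\<exists>t. y = t *s x)"
  by (auto simp: vec.span_singleton)

lemma pg2_points_eq: "pg2_points = {vec.span {x} | x. x \<noteq> (0 :: 'a::field ^ 3)}"
proof (intro equalityI subsetI)
  fix S :: "('a ^ 3) set" assume "S \<in> pg2_points"
  then have S: "vec.subspace S" "vec.dim S = 1" by (auto simp: pg2_points_def)
  obtain B where B: "B \<subseteq> S" "vec.independent B" "S \<subseteq> vec.span B" "card B = vec.dim S"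
    by (rule vec.basis_exists)
  then obtain x where x: "B = {x}" using S(2) by (metis card_1_singletonE)
  then have "x \<noteq> 0" using B(2) vec.dependent_zero by blast
  moreover have "S = vec.span {x}" using B(1,3) S(1) x vec.span_minimal by blast
  ultimately show "S \<in> {vec.span {x} | x. x \<noteq> 0}" by blast
next
  fix S :: "('a ^ 3) set" assume "S \<in> {vec.span {x} | x. x \<noteq> 0}"
  then obtain x where x: "x \<noteq> 0" "S = vec.span {x}" by blast
  have "vec.independent {x}" using x(1) by simp
  then have "vec.dim S = 1" using x(2) by (simp add: vec.dim_span_eq_card_independent)
  then show "S \<in> pg2_points" using x(2) by (simp add: pg2_points_def)
qed

lemma orthogonal_span_iff:
  "orthogonal_subspaces (vec.span {x}) (vec.span {y}) \<longleftrightarrow> scalar_product x (y :: 'a::field ^ 3) = 0"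
proof
  assume "orthogonal_subspaces (vec.span {x}) (vec.span {y})"
  then show "scalar_product x y = 0"
    unfolding orthogonal_subspaces_def by (meson insertI1 vec.span_base)
next
  assume 0: "scalar_product x y = 0"
  have "scalar_product (s *s x) (t *s y) = s * t * scalar_product x y" for s t
    by (simp add: scalar_product_3 algebra_simps)
  then show "orthogonal_subspaces (vec.span {x}) (vec.span {y})"
    using 0 by (auto simp: orthogonal_subspaces_def mem_span_singleton)
qed

lemma span_eq_iff_cross:
  assumes "x \<noteq> 0" "y \<noteq> (0 :: 'a::field ^ 3)"
  shows "vec.span {x} = vec.span {y} \<longleftrightarrow> cross x y = 0"
proof
  assume "vec.span {x} = vec.span {y}"
  then have "y \<in> vec.span {x}" by (simp add: vec.span_base)
  then obtain t where "y = t *s x" by (auto simp: mem_span_singleton)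
  then show "cross x y = 0" by (simp add: vec3_eq_iff)
next
  assume 0: "cross x y = 0"
  then have "cross y x = 0" by (auto simp: vec3_eq_iff mult.commute)
  then obtain s t where "y = t *s x" "x = s *s y"
    using cross_eq_0D assms 0 by metis
  then have "y \<in> vec.span {x}" "x \<in> vec.span {y}" by (auto simp: mem_span_singleton)
  then show "vec.span {x} = vec.span {y}"
    using vec.span_minimal[of "{y}" "vec.span {x}"] vec.span_minimal[of "{x}" "vec.span {y}"]
    by auto
qed

text \<open>The point is spanned by the cross product of representatives, which is nonzero because
  the points differ; uniqueness is the triple product expansion.\<close>

lemma ex1_orthogonal_point:
  assumes "S \<in> pg2_points" "T \<in> pg2_points" "S \<noteq> (T :: ('a::field ^ 3) set)"
  shows "\<exists>!U. U \<in> pg2_points \<and> orthogonal_subspaces U S \<and> orthogonal_subspaces U T"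
proof -
  obtain x y where x: "x \<noteq> 0" "S = vec.span {x}" and y: "y \<noteq> 0" "T = vec.span {y}"
    using assms(1,2) unfolding pg2_points_eq by blast
  define w where "w = cross x y"
  have w: "w \<noteq> 0" using assms(3) x y span_eq_iff_cross by (auto simp: w_def)
  show ?thesis
  proof (intro ex1I[of _ "vec.span {w}"] conjI)
    show "vec.span {w} \<in> pg2_points" using w by (auto simp: pg2_points_eq)
    show "orthogonal_subspaces (vec.span {w}) S" "orthogonal_subspaces (vec.span {w}) T"
      using x y by (simp_all add: orthogonal_span_iff w_def scalar_product_cross)
  next
    fix U assume U: "U \<in> pg2_points \<and> orthogonal_subspaces U S \<and> orthogonal_subspaces U T"
    then obtain z where z: "z \<noteq> 0" "U = vec.span {z}" unfolding pg2_points_eq by blast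
    have "scalar_product z x = 0" "scalar_product z y = 0"
      using U z x y by (simp_all add: orthogonal_span_iff)
    then have "cross z w = 0" by (simp add: w_def cross_cross vec3_eq_iff)
    then show "U = vec.span {w}" using span_eq_iff_cross[OF z(1) w] z(2) by simp
  qed
qed

text \<open>In each case the cross product of the two witnesses is, up to sign, the nonzero
  coordinate times \<open>x\<close>.\<close>

lemma ex_orthogonal_pair:
  assumes "x \<noteq> (0 :: 'a::field ^ 3)"
  obtains y1 y2 where "scalar_product y1 x = 0" "scalar_product y2 x = 0" "cross y1 y2 \<noteq> 0"
proof -
  consider "x$1 \<noteq> 0" | "x$2 \<noteq> 0" | "x$3 \<noteq> 0"
    using assms by (auto simp: vec3_eq_iff)
  then show ?thesis
  proof cases
    case 1
    then show ?thesis
      by (intro that[of "vector [- x$2, x$1, 0]" "vector [- x$3, 0, x$1]"])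
        (auto simp: scalar_product_3 vec3_eq_iff)
  next
    case 2
    then show ?thesis
      by (intro that[of "vector [x$2, - x$1, 0]" "vector [0, - x$3, x$2]"])
        (auto simp: scalar_product_3 vec3_eq_iff)
  next
    case 3
    then show ?thesis
      by (intro that[of "vector [x$3, 0, - x$1]" "vector [0, x$3, - x$2]"])
        (auto simp: scalar_product_3 vec3_eq_iff)
  qed
qed

text \<open>The polar line is parametrized by the field together with a point at infinity:
  \<open>Some t\<close> stands for \<open>y1 + t *s y2\<close> and \<open>None\<close> for
  \<open>y2\<close>. Injectivity gives q + 1 points.\<close>

lemma card_orthogonal_points:
  assumes "S \<in> (pg2_points :: ('a::{field, finite} ^ 3) set set)"
  shows "CARD('a) < card {U \<in> pg2_points. orthogonal_subspaces U S}"
proof -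
  obtain x where x: "x \<noteq> 0" "S = vec.span {x}" using assms unfolding pg2_points_eq by blast
  obtain y1 y2 where y: "scalar_product y1 x = 0" "scalar_product y2 x = 0" "cross y1 y2 \<noteq> 0"
    using ex_orthogonal_pair[OF x(1)] .
  define g where "g p = (case p of None \<Rightarrow> y2 | Some t \<Rightarrow> y1 + t *s y2)" for p :: "'a option"
  have cross_g: "cross (g p) (g p') = (case (p, p') of (None, None) \<Rightarrow> 0
    | (None, Some t) \<Rightarrow> (- 1) *s cross y1 y2 | (Some t, None) \<Rightarrow> cross y1 y2
    | (Some s, Some t) \<Rightarrow> (t - s) *s cross y1 y2)" for p p'
    by (cases p; cases p') (simp_all add: g_def vec3_eq_iff algebra_simps)
  have ne: "g p \<noteq> 0" for p
  proof
    assume "g p = 0"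
    \<comment> \<open>Comparing with a different parameter suffices, since there the cross product
      is \<open>cross y1 y2\<close> up to sign.\<close>
    then have "cross (g p) (g (if p = None then Some 0 else None)) = 0"
      by (simp add: vec3_eq_iff)
    then show False using y(3) unfolding cross_g by (cases p) (auto simp: vec3_eq_iff)
  qed
  have "p = p'" if "cross (g p) (g p') = 0" for p p'
    using that y(3) unfolding cross_g
    by (cases p; cases p') (auto simp: vec3_eq_iff)
  then have "inj (\<lambda>p. vec.span {g p})"
    by (intro injI) (simp add: span_eq_iff_cross ne)
  then have "card (range (\<lambda>p. vec.span {g p})) = CARD('a option)"
    by (rule card_image)
  moreover have "range (\<lambda>p. vec.span {g p}) \<subseteq> {U \<in> pg2_points. orthogonal_subspaces U S}"
  proof -
    have "scalar_product (g p) x = 0" for p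
    proof -
      have "scalar_product (y1 + t *s y2) x = scalar_product y1 x + t * scalar_product y2 x" for t
        by (simp add: scalar_product_3 algebra_simps)
      then show ?thesis using y by (simp add: g_def split: option.split)
    qed
    then show ?thesis using ne by (auto simp: pg2_points_eq x(2) orthogonal_span_iff)
  qed
  then have "card (range (\<lambda>p. vec.span {g p})) \<le> card {U \<in> pg2_points. orthogonal_subspaces U S}"
    by (intro card_mono) simp_all
  ultimately have "CARD('a option) \<le> card {U \<in> pg2_points. orthogonal_subspaces U S}"
    by linarith
  then show ?thesis by (simp add: card_UNIV_option)
qed

text \<open>This rules out the orders 33 = 3 * 11 and 55 = 5 * 11, for which
  \<open>path_budget\<close> makes exceptions.\<close>

lemma primepow_prime_divisors:
  assumes "primepow n" "prime p" "prime r" "p dvd n" "r dvd (n :: nat)"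
  shows "p = r"
  using assms unfolding primepow_def
  by (metis prime_dvd_power primes_dvd_imp_eq)

theorem theorem21:
  fixes q k :: nat
  assumes "primepow q"
    and "CARD('a::{field, finite}) = q"
    and "k > 0"
    and "5 * (int k)\<^sup>2 - int k - 10 \<le> 2 * int q"
  shows "vertex_minor_universal k
           (orthogonality_graph :: ('a ^ 3) set pair_pre_digraph)"
proof -
  let ?P = "pg2_points :: ('a ^ 3) set set"
  interpret polarity_plane ?P orthogonal_subspaces q
  proof
    show "finite ?P" by simp
    show "orthogonal_subspaces T S" if "orthogonal_subspaces S T" for S T :: "('a ^ 3) set"
      using that by (rule orthogonal_subspaces_sym[THEN iffD1])
    show "\<exists>!U. U \<in> ?P \<and> orthogonal_subspaces U S \<and> orthogonal_subspaces U T"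
      if "S \<in> ?P" "T \<in> ?P" "S \<noteq> T" for S T
      using that by (rule ex1_orthogonal_point)
    show "q < card {U \<in> ?P. orthogonal_subspaces U S}" if "S \<in> ?P" for S
      using card_orthogonal_points[OF that] assms(2) by simp
  qed
  have "prime (3 :: nat)" "prime (5 :: nat)" "prime (11 :: nat)" by simp_all
  then have q: "q \<noteq> 33" "q \<noteq> 55"
    using primepow_prime_divisors[OF assms(1), of 3 11]
      primepow_prime_divisors[OF assms(1), of 5 11] by auto
  \<comment> \<open>In terms of M = \<open>k choose 2\<close>, the expression
    \<open>5 * k\<^sup>2 - k\<close> is twice \<open>5 * M + 2 * k\<close>.\<close>
  have "2 * (k choose 2) + k = k * k"
    by (cases k) (simp_all add: choose_two algebra_simps)
  then have "2 * int (k choose 2) + int k = (int k)\<^sup>2"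
    by (metis of_nat_add of_nat_mult of_nat_numeral power2_eq_square)
  then have size: "5 * (k choose 2) + 2 * k \<le> q + 5"
    using assms(4) by linarith
  \<comment> \<open>For k at least 2, bounding the square below by 2k turns the hypothesis into 9k
    \<le> 2q + 10; k = 1 is separate because this bound fails there.\<close>
  have "k \<le> q + 1"
  proof (cases "k = 1")
    case False
    then have "2 * int k \<le> (int k)\<^sup>2" using assms(3) by (simp add: power2_eq_square)
    then show ?thesis using assms(3,4) False by linarith
  qed simp
  moreover have "q < card ?P"
  proof -
    have "vec.span {axis 1 1} \<in> ?P"
      by (auto simp: pg2_points_eq vec3_eq_iff axis_def intro!: exI[of _ "axis 1 1"])
    then have "q < card {U \<in> ?P. orthogonal_subspaces U (vec.span {axis 1 1})}"
      by (rule card_polar)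
    also have "\<dots> \<le> card ?P" by (intro card_mono) auto
    finally show ?thesis .
  qed
  ultimately have "k \<le> card ?P" by linarith
  moreover have "vertex_minor (orthogonality_graph :: ('a ^ 3) set pair_pre_digraph) H"
    if "K \<subseteq> ?P" "card K = k" "pair_graph H" "pverts H = K" for K H
    using vertex_minor_polarity_graph[OF that(1,3,4)] that(2) size q
    by (simp add: orthogonality_graph_def)
  ultimately show ?thesis
    by (auto simp: vertex_minor_universal_def orthogonality_graph_def)
qed

end
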